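(* Let $(A,\Phi)$ be an $\ell$EAS. The associative products in $\mathrm{Sym}\mathbf{As}_\Phi(2)$ (i.e. the elements $m$ such that $m\circ_1m=m\circ_2m$) are exactly the elements of the form $m=*_a$ or $m=*_a^{op}$, where $a\in A$ is such that $\Phi(a\otimes a)=a\otimes a$. The products $m\in\mathrm{Sym}\mathbf{As}_\Phi(2)$ such that $m\circ_2m=0$ are exactly the elements of the form $m=*_a$, where $a\in A$ is such that $\Phi(a\otimes a)=0$.
   Context: All vector spaces are over a field $\mathbb{K}$. Sweedler-like notation: $\Phi(a\otimes b)=\sum a'\rightarrow b'\otimes a''\triangleright b''$ (purely symbolic), for a linear map $\Phi:A\otimes A\to A\otimes A$. $(A,\Phi)$ is an $\ell$EAS if $(\mathrm{Id}\otimes\Phi)\circ(\Phi\otimes\mathrm{Id})\circ(\mathrm{Id}\otimes\Phi)=(\Phi\otimes\mathrm{Id})\circ(\mathrm{Id}\otimes\tau)\circ(\Phi\otimes\mathrm{Id})$ on $A^{\otimes 3}$, where $\tau(a\otimes b)=b\otimes a$. A $\Phi$-associative algebra is a vector space $V$ with bilinear products $*_a$, linear in $a\in A$, such that $x*_a(y*_bz)=\sum(x*_{a''\triangleright b''}y)*_{a'\rightarrow b'}z$. $\mathrm{Sym}\mathbf{As}_\Phi$ is the symmetric operad of $\Phi$-associative algebras: it is the symmetrisation of the nonsymmetric operad $\mathbf{As}_\Phi$ generated by the space of binary operations $A$ (with $a\in A$ corresponding to $*_a$) with relations $a\circ_2b=\sum(a'\rightarrow b')\circ_1(a''\triangleright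 b'')$; so every element of $\mathrm{Sym}\mathbf{As}_\Phi(2)$ is uniquely $*_a+*_b^{op}$ with $a,b\in A$, where $x*_b^{op}y=y*_bx$. *)

theory Defs
  imports
    "HOL-Library.Poly_Mapping"
    "HOL-Library.Set_Algebras"
    "HOL-Library.FuncSet"
    "HOL-Combinatorics.Multiset_Permutations"
begin

section \<open>Free vector spaces and their quotients\<close>

text \<open>
  The free vector space on a type \<open>'x\<close> is \<open>'x \<Rightarrow>\<^sub>0 'k\<close>. A quotient by a subspace \<open>U\<close> is
  represented by its cosets \<open>x +o U\<close>; the sum of two cosets is their elementwise sum.
\<close>

definition fscale :: "'k::field \<Rightarrow> ('x \<Rightarrow>\<^sub>0 'k) \<Rightarrow> ('x \<Rightarrow>\<^sub>0 'k)" where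
  "fscale c p = Poly_Mapping.map (\<lambda>d. c * d) p"

lemma lookup_fscale [simp]: "Poly_Mapping.lookup (fscale c p) x = c * Poly_Mapping.lookup p x"
  by (simp add: fscale_def Poly_Mapping.map.rep_eq when_def)

interpretation free: vector_space fscale
  by unfold_locales (auto intro!: poly_mapping_eqI simp: lookup_add algebra_simps)

definition basis_vec :: "'x \<Rightarrow> ('x \<Rightarrow>\<^sub>0 'k::field)" where
  "basis_vec x = Poly_Mapping.single x 1"

definition lin_ext :: "('x \<Rightarrow> ('y \<Rightarrow>\<^sub>0 'k)) \<Rightarrow> ('x \<Rightarrow>\<^sub>0 'k::field) \<Rightarrow> ('y \<Rightarrow>\<^sub>0 'k)" where
  "lin_ext g p = (\<Sum>x\<in>Poly_Mapping.keys p. fscale (Poly_Mapping.lookup p x) (g x))"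

text \<open>
  In the quotient by \<open>U\<close>, adding \<open>U\<close> only matters for \<open>c = 0\<close>, where the image of a coset
  is the singleton of \<open>0\<close> instead of the zero coset \<open>U\<close>.
\<close>

definition qscale :: "('x \<Rightarrow>\<^sub>0 'k) set \<Rightarrow> 'k::field \<Rightarrow> ('x \<Rightarrow>\<^sub>0 'k) set \<Rightarrow> ('x \<Rightarrow>\<^sub>0 'k) set" where
  "qscale U c X = fscale c ` X + U"

definition rep :: "'v set \<Rightarrow> 'v" where
  "rep X = (SOME x. x \<in> X)"

section \<open>Tensor powers\<close>

text \<open>
  The pure tensor \<open>a\<^sub>1 \<otimes> \<dots> \<otimes> a\<^sub>n\<close> is the coset of the word \<open>[a\<^sub>1, \<dots>, a\<^sub>n]\<close>.
  Here \<open>scale\<close> is the scalar multiplication of the vector space \<open>A = UNIV :: 'a set\<close>.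
\<close>

definition multilinear_rel ::
  "('k::field \<Rightarrow> 'a::ab_group_add \<Rightarrow> 'a) \<Rightarrow> nat \<Rightarrow> ('a list \<Rightarrow>\<^sub>0 'k) set" where
  "multilinear_rel scale n = free.span
     ({basis_vec (u @ (a + b) # v) - basis_vec (u @ a # v) - basis_vec (u @ b # v)
         | u v a b. length u + length v + 1 = n} \<union>
      {basis_vec (u @ scale c a # v) - fscale c (basis_vec (u @ a # v))
         | u v a c. length u + length v + 1 = n})"

definition tensor_power ::
  "('k::field \<Rightarrow> 'a::ab_group_add \<Rightarrow> 'a) \<Rightarrow> nat \<Rightarrow> ('a list \<Rightarrow>\<^sub>0 'k) set set" where
  "tensor_power scale n =
     {x +o multilinear_rel scale n | x. \<forall>w\<in>Poly_Mapping.keys x. length w = n}"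

definition pure_tensor ::
  "('k::field \<Rightarrow> 'a::ab_group_add \<Rightarrow> 'a) \<Rightarrow> 'a list \<Rightarrow> ('a list \<Rightarrow>\<^sub>0 'k) set" where
  "pure_tensor scale w = basis_vec w +o multilinear_rel scale (length w)"

definition linear_tensor_endo ::
  "('k::field \<Rightarrow> 'a::ab_group_add \<Rightarrow> 'a) \<Rightarrow> nat
    \<Rightarrow> (('a list \<Rightarrow>\<^sub>0 'k) set \<Rightarrow> ('a list \<Rightarrow>\<^sub>0 'k) set) \<Rightarrow> bool" where
  "linear_tensor_endo scale n F \<longleftrightarrow>
     (\<forall>X\<in>tensor_power scale n. F X \<in> tensor_power scale n) \<and>
     (\<forall>X\<in>tensor_power scale n. \<forall>Y\<in>tensor_power scale n. F (X + Y) = F X + F Y) \<and>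
     (\<forall>c. \<forall>X\<in>tensor_power scale n.
        F (qscale (multilinear_rel scale n) c X) = qscale (multilinear_rel scale n) c (F X))"

text \<open>\<open>\<tau>(a \<otimes> b) = b \<otimes> a\<close>\<close>

definition tensor_flip ::
  "('k::field \<Rightarrow> 'a::ab_group_add \<Rightarrow> 'a) \<Rightarrow> ('a list \<Rightarrow>\<^sub>0 'k) set \<Rightarrow> ('a list \<Rightarrow>\<^sub>0 'k) set" where
  "tensor_flip scale X = lin_ext (\<lambda>w. basis_vec (rev w)) (rep X) +o multilinear_rel scale 2"

text \<open>
  For linear \<open>F\<close> on \<open>A \<otimes> A\<close>, \<open>tensor_at scale n j F\<close> is \<open>Id \<otimes> \<dots> \<otimes> F \<otimes> \<dots> \<otimes> Id\<close> on
  \<open>A\<^sup>\<otimes>\<^sup>n\<close>, with \<open>j\<close> identity factors on the left: the factors number \<open>j\<close> and \<open>j + 1\<close>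
  (from 0) of a word are replaced by a representative of the value of \<open>F\<close> on them. The coset does
  not depend on the representatives.
\<close>

definition tensor_at ::
  "('k::field \<Rightarrow> 'a::ab_group_add \<Rightarrow> 'a) \<Rightarrow> nat \<Rightarrow> nat
    \<Rightarrow> (('a list \<Rightarrow>\<^sub>0 'k) set \<Rightarrow> ('a list \<Rightarrow>\<^sub>0 'k) set)
    \<Rightarrow> ('a list \<Rightarrow>\<^sub>0 'k) set \<Rightarrow> ('a list \<Rightarrow>\<^sub>0 'k) set" where
  "tensor_at scale n j F X =
     lin_ext (\<lambda>w. lin_ext (\<lambda>v. basis_vec (take j w @ v @ drop (j + 2) w))
                    (rep (F (pure_tensor scale (take 2 (drop j w))))))
       (rep X)
     +o multilinear_rel scale n"

definition lEAS ::
  "('k::field \<Rightarrow> 'a::ab_group_add \<Rightarrow> 'a)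
    \<Rightarrow> (('a list \<Rightarrow>\<^sub>0 'k) set \<Rightarrow> ('a list \<Rightarrow>\<^sub>0 'k) set) \<Rightarrow> bool" where
  "lEAS scale \<Phi> \<longleftrightarrow>
     vector_space scale \<and> linear_tensor_endo scale 2 \<Phi> \<and>
     (\<forall>X\<in>tensor_power scale 3.
        tensor_at scale 3 1 \<Phi> (tensor_at scale 3 0 \<Phi> (tensor_at scale 3 1 \<Phi> X)) =
        tensor_at scale 3 0 \<Phi> (tensor_at scale 3 1 (tensor_flip scale) (tensor_at scale 3 0 \<Phi> X)))"

section \<open>The nonsymmetric operad \<open>As\<^sub>\<Phi>\<close>\<close>

text \<open>
  Planar binary trees with inner vertices labelled by a set form a basis of the free nonsymmetric
  operad generated by this set in arity 2. The tree \<open>Node a l r\<close> is the operation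
  \<open>l *\<^sub>a r\<close>. \<open>graft i t s\<close> grafts \<open>s\<close> on leaf number \<open>i\<close> of \<open>t\<close>, counting from 1.
\<close>

datatype 'a ptree = Leaf | Node 'a "'a ptree" "'a ptree"

fun leaves :: "'a ptree \<Rightarrow> nat" where
  "leaves Leaf = 1"
| "leaves (Node a l r) = leaves l + leaves r"

fun graft :: "nat \<Rightarrow> 'a ptree \<Rightarrow> 'a ptree \<Rightarrow> 'a ptree" where
  "graft i Leaf s = s"
| "graft i (Node a l r) s =
     (if i \<le> leaves l then Node a (graft i l s) r else Node a l (graft (i - leaves l) r s))"

definition free_op :: "nat \<Rightarrow> ('a ptree \<Rightarrow>\<^sub>0 'k::field) set" where
  "free_op n = {x. \<forall>t\<in>Poly_Mapping.keys x. leaves t = n}"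

definition free_comp ::
  "nat \<Rightarrow> ('a ptree \<Rightarrow>\<^sub>0 'k::field) \<Rightarrow> ('a ptree \<Rightarrow>\<^sub>0 'k) \<Rightarrow> ('a ptree \<Rightarrow>\<^sub>0 'k)" where
  "free_comp i x y = lin_ext (\<lambda>t. lin_ext (\<lambda>s. basis_vec (graft i t s)) y) x"

text \<open>\<open>operad_ideal R n\<close> is the arity \<open>n\<close> component of the operadic ideal generated by \<open>R\<close>.\<close>

inductive operad_ideal ::
  "(nat \<Rightarrow> ('a ptree \<Rightarrow>\<^sub>0 'k::field) set) \<Rightarrow> nat \<Rightarrow> ('a ptree \<Rightarrow>\<^sub>0 'k) \<Rightarrow> bool"
  for R where
  gen: "x \<in> R n \<Longrightarrow> operad_ideal R n x"
| zero: "operad_ideal R n 0"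
| add: "operad_ideal R n x \<Longrightarrow> operad_ideal R n y \<Longrightarrow> operad_ideal R n (x + y)"
| scale: "operad_ideal R n x \<Longrightarrow> operad_ideal R n (fscale c x)"
| comp_left: "operad_ideal R n x \<Longrightarrow> y \<in> free_op m \<Longrightarrow> 1 \<le> i \<Longrightarrow> i \<le> m
    \<Longrightarrow> operad_ideal R (m + n - 1) (free_comp i y x)"
| comp_right: "operad_ideal R n x \<Longrightarrow> y \<in> free_op m \<Longrightarrow> 1 \<le> i \<Longrightarrow> i \<le> n
    \<Longrightarrow> operad_ideal R (n + m - 1) (free_comp i x y)"

definition corolla :: "'a \<Rightarrow> ('a ptree \<Rightarrow>\<^sub>0 'k::field)" where
  "corolla a = basis_vec (Node a Leaf Leaf)"

text \<open>
  In arity 2, the relations turn the free operad on the set \<open>A\<close> into the free operad on the vector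
  space \<open>A\<close>. In arity 3, they are \<open>a \<circ>\<^sub>2 b = \<Sum> (a' \<rightarrow> b') \<circ>\<^sub>1 (a'' \<triangleright> b'')\<close>, where \<open>y\<close> is any
  representative of \<open>\<Phi>(a \<otimes> b) = \<Sum> a' \<rightarrow> b' \<otimes> a'' \<triangleright> b''\<close>.
\<close>

definition as_rel ::
  "('k::field \<Rightarrow> 'a::ab_group_add \<Rightarrow> 'a)
    \<Rightarrow> (('a list \<Rightarrow>\<^sub>0 'k) set \<Rightarrow> ('a list \<Rightarrow>\<^sub>0 'k) set)
    \<Rightarrow> nat \<Rightarrow> ('a ptree \<Rightarrow>\<^sub>0 'k) set" where
  "as_rel scale \<Phi> n =
     (if n = 2 then
        {corolla (a + b) - corolla a - corolla b | a b. True} \<union>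
        {corolla (scale c a) - fscale c (corolla a) | c a. True}
      else if n = 3 then
        {free_comp 2 (corolla a) (corolla b) -
           lin_ext (\<lambda>w. free_comp 1 (corolla (w ! 0)) (corolla (w ! 1))) y
         | a b y. y \<in> \<Phi> (pure_tensor scale [a, b])}
      else {})"

definition as_ideal ::
  "('k::field \<Rightarrow> 'a::ab_group_add \<Rightarrow> 'a)
    \<Rightarrow> (('a list \<Rightarrow>\<^sub>0 'k) set \<Rightarrow> ('a list \<Rightarrow>\<^sub>0 'k) set)
    \<Rightarrow> nat \<Rightarrow> ('a ptree \<Rightarrow>\<^sub>0 'k) set" where
  "as_ideal scale \<Phi> n = {x. operad_ideal (as_rel scale \<Phi>) n x}"

definition As ::
  "('k::field \<Rightarrow> 'a::ab_group_add \<Rightarrow> 'a)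
    \<Rightarrow> (('a list \<Rightarrow>\<^sub>0 'k) set \<Rightarrow> ('a list \<Rightarrow>\<^sub>0 'k) set)
    \<Rightarrow> nat \<Rightarrow> ('a ptree \<Rightarrow>\<^sub>0 'k) set set" where
  "As scale \<Phi> n = {x +o as_ideal scale \<Phi> n | x. x \<in> free_op n}"

text \<open>The partial composition \<open>\<circ>\<^sub>i : As\<^sub>\<Phi>(m) \<otimes> As\<^sub>\<Phi>(n) \<rightarrow> As\<^sub>\<Phi>(m + n - 1)\<close>.\<close>

definition As_comp ::
  "('k::field \<Rightarrow> 'a::ab_group_add \<Rightarrow> 'a)
    \<Rightarrow> (('a list \<Rightarrow>\<^sub>0 'k) set \<Rightarrow> ('a list \<Rightarrow>\<^sub>0 'k) set)
    \<Rightarrow> nat \<Rightarrow> nat \<Rightarrow> nat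
    \<Rightarrow> ('a ptree \<Rightarrow>\<^sub>0 'k) set \<Rightarrow> ('a ptree \<Rightarrow>\<^sub>0 'k) set \<Rightarrow> ('a ptree \<Rightarrow>\<^sub>0 'k) set" where
  "As_comp scale \<Phi> m n i X Y = free_comp i (rep X) (rep Y) +o as_ideal scale \<Phi> (m + n - 1)"

section \<open>Its symmetrisation\<close>

text \<open>
  The symmetrisation of an operad \<open>P\<close> is \<open>n \<mapsto> P(n) \<otimes> K[S\<^sub>n]\<close>, whose elements are families of
  elements of \<open>P(n)\<close> indexed by \<open>S\<^sub>n\<close>. A permutation is given as a word \<open>w\<close> with letters
  \<open>1, \<dots>, n\<close>, and \<open>p \<otimes> w\<close> stands for the operation
  \<open>(x\<^sub>1, \<dots>, x\<^sub>n) \<mapsto> p(x\<^bsub>w\<^sub>1\<^esub>, \<dots>, x\<^bsub>w\<^sub>n\<^esub>)\<close>.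
  Composing at input \<open>i\<close>, one substitutes the second operation for \<open>x\<^sub>i\<close>: in the word, the letter
  \<open>i\<close> is replaced by \<open>v\<close> shifted by \<open>i - 1\<close> and the letters above \<open>i\<close> are shifted by
  \<open>n - 1\<close>; in \<open>P\<close>, the composition takes place at the position of \<open>i\<close> in \<open>w\<close>.
\<close>

abbreviation Sym :: "nat \<Rightarrow> nat list set" where
  "Sym n \<equiv> permutations_of_set {1..n}"

definition word_comp :: "nat \<Rightarrow> nat list \<Rightarrow> nat list \<Rightarrow> nat list" where
  "word_comp i w v = concat (map (\<lambda>j.
     if j < i then [j]
     else if j = i then map (\<lambda>l. l + i - 1) v
     else [j + length v - 1]) w)"

definition word_pos :: "nat \<Rightarrow> nat list \<Rightarrow> nat" where
  "word_pos i w = (THE k. 1 \<le> k \<and> k \<le> length w \<and> w ! (k - 1) = i)"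

definition SymAs ::
  "('k::field \<Rightarrow> 'a::ab_group_add \<Rightarrow> 'a)
    \<Rightarrow> (('a list \<Rightarrow>\<^sub>0 'k) set \<Rightarrow> ('a list \<Rightarrow>\<^sub>0 'k) set)
    \<Rightarrow> nat \<Rightarrow> (nat list \<Rightarrow> ('a ptree \<Rightarrow>\<^sub>0 'k) set) set" where
  "SymAs scale \<Phi> n = Sym n \<rightarrow>\<^sub>E As scale \<Phi> n"

definition SymAs_zero ::
  "('k::field \<Rightarrow> 'a::ab_group_add \<Rightarrow> 'a)
    \<Rightarrow> (('a list \<Rightarrow>\<^sub>0 'k) set \<Rightarrow> ('a list \<Rightarrow>\<^sub>0 'k) set)
    \<Rightarrow> nat \<Rightarrow> nat list \<Rightarrow> ('a ptree \<Rightarrow>\<^sub>0 'k) set" where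
  "SymAs_zero scale \<Phi> n = (\<lambda>w\<in>Sym n. as_ideal scale \<Phi> n)"

text \<open>Adding the ideal makes the empty sum the zero coset.\<close>

definition SymAs_comp ::
  "('k::field \<Rightarrow> 'a::ab_group_add \<Rightarrow> 'a)
    \<Rightarrow> (('a list \<Rightarrow>\<^sub>0 'k) set \<Rightarrow> ('a list \<Rightarrow>\<^sub>0 'k) set)
    \<Rightarrow> nat \<Rightarrow> nat \<Rightarrow> nat
    \<Rightarrow> (nat list \<Rightarrow> ('a ptree \<Rightarrow>\<^sub>0 'k) set) \<Rightarrow> (nat list \<Rightarrow> ('a ptree \<Rightarrow>\<^sub>0 'k) set)
    \<Rightarrow> (nat list \<Rightarrow> ('a ptree \<Rightarrow>\<^sub>0 'k) set)" where
  "SymAs_comp scale \<Phi> m n i f g =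
     (\<lambda>u\<in>Sym (m + n - 1).
        (\<Sum>(w, v)\<in>{(w, v). w \<in> Sym m \<and> v \<in> Sym n \<and> word_comp i w v = u}.
           As_comp scale \<Phi> m n (word_pos i w) (f w) (g v))
        + as_ideal scale \<Phi> (m + n - 1))"

text \<open>The element \<open>p \<otimes> w\<close> of \<open>P(n) \<otimes> K[S\<^sub>n]\<close>.\<close>

definition SymAs_elem ::
  "('k::field \<Rightarrow> 'a::ab_group_add \<Rightarrow> 'a)
    \<Rightarrow> (('a list \<Rightarrow>\<^sub>0 'k) set \<Rightarrow> ('a list \<Rightarrow>\<^sub>0 'k) set)
    \<Rightarrow> nat \<Rightarrow> ('a ptree \<Rightarrow>\<^sub>0 'k) set \<Rightarrow> nat list
    \<Rightarrow> (nat list \<Rightarrow> ('a ptree \<Rightarrow>\<^sub>0 'k) set)" where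
  "SymAs_elem scale \<Phi> n p w = (\<lambda>u\<in>Sym n. if u = w then p else as_ideal scale \<Phi> n)"

definition star ::
  "('k::field \<Rightarrow> 'a::ab_group_add \<Rightarrow> 'a)
    \<Rightarrow> (('a list \<Rightarrow>\<^sub>0 'k) set \<Rightarrow> ('a list \<Rightarrow>\<^sub>0 'k) set)
    \<Rightarrow> 'a \<Rightarrow> (nat list \<Rightarrow> ('a ptree \<Rightarrow>\<^sub>0 'k) set)" where
  "star scale \<Phi> a = SymAs_elem scale \<Phi> 2 (corolla a +o as_ideal scale \<Phi> 2) [1, 2]"

definition star_op ::
  "('k::field \<Rightarrow> 'a::ab_group_add \<Rightarrow> 'a)
    \<Rightarrow> (('a list \<Rightarrow>\<^sub>0 'k) set \<Rightarrow> ('a list \<Rightarrow>\<^sub>0 'k) set)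
    \<Rightarrow> 'a \<Rightarrow> (nat list \<Rightarrow> ('a ptree \<Rightarrow>\<^sub>0 'k) set)" where
  "star_op scale \<Phi> a = SymAs_elem scale \<Phi> 2 (corolla a +o as_ideal scale \<Phi> 2) [2, 1]"

end

theory Submission
  imports Defs
begin

text \<open>
  For \<open>m = *\<^sub>a + *\<^sub>b\<^sup>o\<^sup>p\<close>, compare \<open>m \<circ>\<^sub>1 m\<close> and \<open>m \<circ>\<^sub>2 m\<close> on the six words in \<open>x, y, z\<close>. The relations
  identify the arity 3 component of the nonsymmetric operad with \<open>A \<otimes> A\<close>, where \<open>a \<circ>\<^sub>1 b\<close> becomes
  \<open>a \<otimes> b\<close> and \<open>a \<circ>\<^sub>2 b\<close> becomes \<open>\<Phi>(a \<otimes> b)\<close>. The words \<open>xyz\<close> and \<open>zyx\<close> give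
  \<open>\<Phi>(a \<otimes> a) = a \<otimes> a\<close> and \<open>\<Phi>(b \<otimes> b) = b \<otimes> b\<close>, and \<open>yxz\<close> gives \<open>a \<otimes> b = 0\<close>, so \<open>a = 0\<close> or \<open>b = 0\<close>;
  then the other words give nothing more. For \<open>m \<circ>\<^sub>2 m = 0\<close>, the word \<open>zyx\<close> gives \<open>b \<otimes> b = 0\<close> and
  \<open>xyz\<close> gives \<open>\<Phi>(a \<otimes> a) = 0\<close>.
\<close>

section \<open>Linear extension of functions on a basis\<close>

text \<open>This generalises \<open>lin_ext\<close> to any target space. Below, values are taken in
  free spaces, in the space A (through \<open>label\<close>) and in the field (through a bilinear
  form); the linearity lemmas serve all three cases.\<close>

definition (in vector_space) lincomb :: "('x \<Rightarrow> 'b) \<Rightarrow> ('x \<Rightarrow>\<^sub>0 'a) \<Rightarrow> 'b" where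
  "lincomb g p = (\<Sum>x\<in>Poly_Mapping.keys p. scale (Poly_Mapping.lookup p x) (g x))"

lemma lin_ext_eq_lincomb: "lin_ext = free.lincomb"
  by (simp add: fun_eq_iff lin_ext_def free.lincomb_def)

context vector_space
begin

lemma lincomb_superset:
  assumes "finite S" "Poly_Mapping.keys p \<subseteq> S"
  shows "lincomb g p = (\<Sum>x\<in>S. scale (Poly_Mapping.lookup p x) (g x))"
  unfolding lincomb_def
  by (rule sum.mono_neutral_left) (use assms in \<open>auto simp: in_keys_iff\<close>)

lemma module_hom_lincomb: "module_hom fscale scale (lincomb g)"
proof (unfold module_hom_iff, intro conjI allI)
  show "module fscale" by (rule free.module_axioms)
  show "module scale" by (rule module_axioms)
  show "lincomb g (p + q) = lincomb g p + lincomb g q" for p q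
  proof -
    let ?S = "Poly_Mapping.keys p \<union> Poly_Mapping.keys q"
    have "Poly_Mapping.keys (p + q) \<subseteq> ?S" by (rule keys_add)
    then show ?thesis
      by (simp add: lincomb_superset[of ?S] lookup_add scale_left_distrib sum.distrib)
  qed
  show "lincomb g (fscale c p) = scale c (lincomb g p)" for c p
  proof -
    have "Poly_Mapping.keys (fscale c p) \<subseteq> Poly_Mapping.keys p"
      by (auto simp: in_keys_iff)
    then show ?thesis
      by (simp add: lincomb_superset[of "Poly_Mapping.keys p"] scale_sum_right)
  qed
qed

lemmas lincomb_add = module_hom.add[OF module_hom_lincomb]
  and lincomb_scale = module_hom.scale[OF module_hom_lincomb]
  and lincomb_zero [simp] = module_hom.zero[OF module_hom_lincomb]
  and lincomb_diff = module_hom.diff[OF module_hom_lincomb]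
  and lincomb_sum = module_hom.sum[OF module_hom_lincomb]

lemma lincomb_basis_vec [simp]: "lincomb g (basis_vec x) = g x"
  by (simp add: lincomb_def basis_vec_def)

lemma lincomb_cong:
  "(\<And>x. x \<in> Poly_Mapping.keys p \<Longrightarrow> g x = h x) \<Longrightarrow> lincomb g p = lincomb h p"
  unfolding lincomb_def by (rule sum.cong) auto

lemma lincomb_in_subspace:
  "subspace W \<Longrightarrow> (\<And>x. x \<in> Poly_Mapping.keys p \<Longrightarrow> g x \<in> W) \<Longrightarrow> lincomb g p \<in> W"
  unfolding lincomb_def by (intro subspace_sum subspace_scale)

lemma lincomb_lin_ext: "lincomb g (lin_ext h p) = lincomb (\<lambda>x. lincomb g (h x)) p"
  by (simp add: lin_ext_def lincomb_sum lincomb_scale lincomb_def[of _ p])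

lemma lincomb_swap:
  "lincomb (\<lambda>x. lincomb (\<lambda>y. g x y) q) p = lincomb (\<lambda>y. lincomb (\<lambda>x. g x y) p) q"
  by (simp add: lincomb_def scale_sum_right mult.commute, subst sum.swap) simp

end

lemmas lin_ext_add = free.lincomb_add[folded lin_ext_eq_lincomb]
  and lin_ext_scale = free.lincomb_scale[folded lin_ext_eq_lincomb]
  and lin_ext_zero [simp] = free.lincomb_zero[folded lin_ext_eq_lincomb]
  and lin_ext_diff = free.lincomb_diff[folded lin_ext_eq_lincomb]
  and lin_ext_basis_vec [simp] = free.lincomb_basis_vec[folded lin_ext_eq_lincomb]
  and lin_ext_cong = free.lincomb_cong[folded lin_ext_eq_lincomb]
  and lin_ext_in_subspace = free.lincomb_in_subspace[folded lin_ext_eq_lincomb]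
  and lin_ext_lin_ext = free.lincomb_lin_ext[folded lin_ext_eq_lincomb]
  and lin_ext_swap = free.lincomb_swap[folded lin_ext_eq_lincomb]

lemma lin_ext_basis_vec_id [simp]: "lin_ext basis_vec p = p"
proof (rule poly_mapping_eqI)
  fix x
  have "Poly_Mapping.lookup (lin_ext basis_vec p) x =
      (\<Sum>y\<in>Poly_Mapping.keys p. if y = x then Poly_Mapping.lookup p y else 0)"
    by (simp add: lin_ext_def lookup_sum basis_vec_def lookup_single when_def mult.commute if_distrib
        cong: if_cong)
  then show "Poly_Mapping.lookup (lin_ext basis_vec p) x = Poly_Mapping.lookup p x"
    by (simp add: in_keys_iff)
qed

lemma keys_basis_vec [simp]: "Poly_Mapping.keys (basis_vec x :: 'x \<Rightarrow>\<^sub>0 'k::field) = {x}"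
  by (simp add: basis_vec_def)

lemma subspace_supported:
  "free.subspace {p :: 'x \<Rightarrow>\<^sub>0 'k::field. \<forall>x\<in>Poly_Mapping.keys p. P x}"
proof (rule free.subspaceI; clarsimp)
  fix p q :: "'x \<Rightarrow>\<^sub>0 'k" and x
  assume "\<forall>x\<in>Poly_Mapping.keys p. P x" "\<forall>x\<in>Poly_Mapping.keys q. P x"
    "x \<in> Poly_Mapping.keys (p + q)"
  then show "P x" using keys_add[of p q] by blast
next
  fix c and p :: "'x \<Rightarrow>\<^sub>0 'k" and x
  assume "\<forall>x\<in>Poly_Mapping.keys p. P x" "x \<in> Poly_Mapping.keys (fscale c p)"
  then show "P x" by (auto simp: in_keys_iff)
qed

section \<open>Cosets\<close>

lemma coset_eq_iff:
  assumes "free.subspace U"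
  shows "x +o U = y +o U \<longleftrightarrow> x - y \<in> U"
proof
  assume "x +o U = y +o U"
  moreover have "x \<in> x +o U"
    using set_plus_intro2[OF free.subspace_0[OF assms], of x] by simp
  ultimately show "x - y \<in> U"
    by (simp add: set_plus_imp_minus)
next
  have *: "x +o U \<subseteq> y +o U" if "x - y \<in> U" for x y
  proof
    fix z assume "z \<in> x +o U"
    then have "(z - x) + (x - y) \<in> U"
      using that free.subspace_add[OF assms] set_plus_imp_minus by blast
    then show "z \<in> y +o U"
      by (intro set_minus_imp_plus) simp
  qed
  assume "x - y \<in> U"
  moreover from this have "y - x \<in> U"
    using free.subspace_neg[OF assms] by fastforce
  ultimately show "x +o U = y +o U"
    using * by blast
qed

lemma coset_eq_subspace_iff: "free.subspace U \<Longrightarrow> x +o U = U \<longleftrightarrow> x \<in> U"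
  using coset_eq_iff[of U x 0] by simp

lemma subspace_plus_self:
  assumes "free.subspace U"
  shows "U + U = U"
  using free.subspace_add[OF assms] free.subspace_0[OF assms]
  by (auto simp: set_plus_def) (metis add_0)

lemma coset_plus:
  "free.subspace U \<Longrightarrow> (x +o U) + (y +o U) = (x + y) +o U"
  by (simp add: set_plus_rearrange subspace_plus_self)

lemma qscale_coset:
  assumes "free.subspace U"
  shows "qscale U c (x +o U) = fscale c x +o U"
proof -
  have "fscale c ` (x +o U) + U = fscale c x +o U"
  proof (intro equalityI subsetI)
    fix z assume "z \<in> fscale c ` (x +o U) + U"
    then obtain u v where "u \<in> U" "v \<in> U" "z = fscale c (x + u) + v"
      by (auto simp: set_plus_def elt_set_plus_def)
    then show "z \<in> fscale c x +o U"
      using assms by (auto simp: free.scale_right_distrib add.assoc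
          intro!: set_plus_intro2 free.subspace_add free.subspace_scale)
  next
    fix z assume "z \<in> fscale c x +o U"
    then obtain v where "v \<in> U" "z = fscale c x + v"
      by (auto simp: elt_set_plus_def)
    then show "z \<in> fscale c ` (x +o U) + U"
      using set_plus_intro2[OF free.subspace_0[OF assms], of x] by auto
  qed
  then show ?thesis by (simp add: qscale_def)
qed

lemma rep_coset:
  assumes "free.subspace U"
  shows "rep (x +o U) - x \<in> U"
proof -
  have "x \<in> x +o U"
    using set_plus_intro2[OF free.subspace_0[OF assms], of x] by simp
  then have "rep (x +o U) \<in> x +o U"
    unfolding rep_def by (rule someI)
  then show ?thesis by (rule set_plus_imp_minus)
qed

section \<open>Compositions of trees\<close>

lemma leaves_pos: "0 < leaves t"
  by (induction t) auto

lemma leaves_eq_1: "leaves t = Suc 0 \<longleftrightarrow> t = Leaf"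
proof (cases t)
  case (Node a l r)
  then show ?thesis using leaves_pos[of l] leaves_pos[of r] by simp
qed simp

lemma leaves_eq_2: "leaves t = 2 \<longleftrightarrow> (\<exists>a. t = Node a Leaf Leaf)"
proof (cases t)
  case (Node a l r)
  then have "leaves t = 2 \<longleftrightarrow> leaves l = 1 \<and> leaves r = 1"
    using leaves_pos[of l] leaves_pos[of r] by auto
  then show ?thesis using Node by (simp add: leaves_eq_1)
qed simp

text \<open>The sum form avoids truncated subtraction. An index out of range reaches the first or
  the last leaf, so no bound on \<open>i\<close> appears.\<close>

lemma leaves_graft: "leaves (graft i t s) + 1 = leaves t + leaves s"
  by (induction i t s rule: graft.induct) auto

lemma graft_Leaf_right [simp]: "graft i t Leaf = t"
  by (induction i t "Leaf :: 'a ptree" rule: graft.induct) auto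

lemma subspace_free_op: "free.subspace (free_op n)"
  unfolding free_op_def by (rule subspace_supported)

lemma free_op_0: "x \<in> free_op 0 \<Longrightarrow> x = 0"
  unfolding free_op_def
  by (metis (mono_tags) mem_Collect_eq leaves_pos less_numeral_extra(3) keys_eq_empty all_not_in_conv)

lemma corolla_in_free_op: "corolla a \<in> free_op 2"
  by (simp add: corolla_def free_op_def)

lemma free_comp_diff_left: "free_comp i (x - x') y = free_comp i x y - free_comp i x' y"
  and free_comp_zero_left [simp]: "free_comp i 0 y = 0"
  by (simp_all add: free_comp_def lin_ext_diff)

text \<open>Summing over the second factor first exhibits the linearity in \<open>y\<close>.\<close>

lemma free_comp_swap:
  "free_comp i x y = lin_ext (\<lambda>s. lin_ext (\<lambda>t. basis_vec (graft i t s)) x) y"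
  unfolding free_comp_def by (rule lin_ext_swap)

lemma free_comp_diff_right: "free_comp i x (y - y') = free_comp i x y - free_comp i x y'"
  and free_comp_zero_right [simp]: "free_comp i x 0 = 0"
  by (simp_all add: free_comp_swap lin_ext_diff)

lemma free_comp_in_free_op:
  assumes "x \<in> free_op m" "y \<in> free_op n"
  shows "free_comp i x y \<in> free_op (m + n - 1)"
  unfolding free_comp_def
proof (intro lin_ext_in_subspace subspace_free_op)
  fix t s assume "t \<in> Poly_Mapping.keys x" "s \<in> Poly_Mapping.keys y"
  then show "basis_vec (graft i t s) \<in> free_op (m + n - 1)"
    using assms leaves_graft[of i t s] by (simp add: free_op_def)
qed

text \<open>\<open>Leaf\<close> is the operadic unit, so composing with an element of arity 1 only
  rescales. This settles the case of \<open>vanishing_comp\<close> in which the arity does not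
  grow.\<close>

lemma free_op_1_scalar:
  assumes "y \<in> free_op 1"
  obtains c where "y = fscale c (basis_vec Leaf)"
proof
  show "y = fscale (Poly_Mapping.lookup y Leaf) (basis_vec Leaf)"
  proof (rule poly_mapping_eqI)
    fix t
    have "t \<noteq> Leaf \<Longrightarrow> t \<notin> Poly_Mapping.keys y"
      using assms by (auto simp: free_op_def leaves_eq_1)
    then show "Poly_Mapping.lookup y t =
        Poly_Mapping.lookup (fscale (Poly_Mapping.lookup y Leaf) (basis_vec Leaf)) t"
      by (auto simp: basis_vec_def lookup_single when_def in_keys_iff)
  qed
qed

lemma free_comp_scalar_left: "free_comp i (fscale c (basis_vec Leaf)) x = fscale c x"
  by (simp add: free_comp_def lin_ext_scale)

lemma free_comp_scalar_right: "free_comp i x (fscale c (basis_vec Leaf)) = fscale c x"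
  by (simp add: free_comp_swap lin_ext_scale)

lemma free_comp_corolla:
  "free_comp 1 (corolla a) (corolla b) = basis_vec (Node a (Node b Leaf Leaf) Leaf)"
  "free_comp 2 (corolla a) (corolla b) = basis_vec (Node a Leaf (Node b Leaf Leaf))"
  by (simp_all add: free_comp_def corolla_def)


section \<open>Maps that are linear modulo a subspace\<close>

text \<open>In terms of representatives: \<open>g\<close> induces a linear map into the quotient of
  the free space by \<open>W\<close>.\<close>

definition (in vector_space) linear_mod :: "('x \<Rightarrow>\<^sub>0 'a) set \<Rightarrow> ('b \<Rightarrow> ('x \<Rightarrow>\<^sub>0 'a)) \<Rightarrow> bool" where
  "linear_mod W g \<longleftrightarrow> (\<forall>a b. g (a + b) - g a - g b \<in> W) \<and>
     (\<forall>c a. g (scale c a) - fscale c (g a) \<in> W)"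

context vector_space
begin

lemma linear_mod_zero:
  assumes "linear_mod W g"
  shows "g 0 \<in> W"
proof -
  have "g (scale 0 0) - fscale 0 (g 0) \<in> W"
    using assms unfolding linear_mod_def by blast
  then show ?thesis by simp
qed

text \<open>Induction on the support: each new summand costs one defect of additivity and one of
  homogeneity, both in \<open>W\<close>. The lemma collapses a combination of trees to the value of
  \<open>g\<close> at the combination of their labels.\<close>

lemma linear_mod_lincomb:
  fixes g :: "'b \<Rightarrow> ('x \<Rightarrow>\<^sub>0 'a)" and h :: "'y \<Rightarrow> 'b"
  assumes W: "free.subspace W" and g: "linear_mod W g"
  shows "lin_ext (\<lambda>x. g (h x)) p - g (lincomb h p) \<in> W"
proof -
  have "(\<Sum>x\<in>S. fscale (c x) (g (h x))) - g (\<Sum>x\<in>S. scale (c x) (h x)) \<in> W" if "finite S" for S c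
    using that
  proof induction
    case empty
    then show ?case using free.subspace_neg[OF W linear_mod_zero[OF g]] by simp
  next
    case (insert y S)
    let ?s = "\<Sum>x\<in>S. fscale (c x) (g (h x))" and ?v = "\<Sum>x\<in>S. scale (c x) (h x)"
    let ?w = "scale (c y) (h y)"
    have "(?s - g ?v) - (g (?w + ?v) - g ?w - g ?v) - (g ?w - fscale (c y) (g (h y))) \<in> W"
      by (rule free.subspace_diff[OF W free.subspace_diff[OF W insert.IH]])
        (use g in \<open>auto simp: linear_mod_def\<close>)
    moreover have "(?s - g ?v) - (g (?w + ?v) - g ?w - g ?v) - (g ?w - fscale (c y) (g (h y)))
        = fscale (c y) (g (h y)) + ?s - g (?w + ?v)"
      by (simp add: algebra_simps)
    ultimately have "fscale (c y) (g (h y)) + ?s - g (?w + ?v) \<in> W"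
      by (simp only:)
    then show ?case using insert.hyps by simp
  qed
  then show ?thesis by (simp add: lin_ext_def lincomb_def)
qed

end

section \<open>The components of arity 2 and 3 of the ideal\<close>

text \<open>The value at \<open>Leaf\<close> is a dummy. The linear extension sends a combination of
  arity 2 trees to the vector of A that it represents in the quotient.\<close>

fun label :: "'a::zero ptree \<Rightarrow> 'a" where
  "label Leaf = 0"
| "label (Node a l r) = a"

locale tensor_square = vector_space scale
  for scale :: "'k::field \<Rightarrow> 'a::ab_group_add \<Rightarrow> 'a" +
  fixes \<Phi> :: "('a list \<Rightarrow>\<^sub>0 'k) set \<Rightarrow> ('a list \<Rightarrow>\<^sub>0 'k) set"
  assumes linear_\<Phi>: "linear_tensor_endo scale 2 \<Phi>"
begin

abbreviation tensor_rel :: "('a list \<Rightarrow>\<^sub>0 'k) set" where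
  "tensor_rel \<equiv> multilinear_rel scale 2"

abbreviation ideal :: "nat \<Rightarrow> ('a ptree \<Rightarrow>\<^sub>0 'k) set" where
  "ideal \<equiv> as_ideal scale \<Phi>"

text \<open>A fixed representative allows linear maps on words to be applied. Being chosen, it is
  bilinear only modulo \<open>tensor_rel\<close>.\<close>

definition \<phi> :: "'a \<Rightarrow> 'a \<Rightarrow> ('a list \<Rightarrow>\<^sub>0 'k)" where
  "\<phi> a b = rep (\<Phi> (pure_tensor scale [a, b]))"

section \<open>The tensor square and representatives of \<Phi>\<close>

lemma subspace_tensor_rel: "free.subspace tensor_rel"
  by (simp add: multilinear_rel_def)

lemma tensor_linear_mod:
  "linear_mod tensor_rel (\<lambda>a. basis_vec [a, b])" "linear_mod tensor_rel (\<lambda>b. basis_vec [a, b])"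
proof -
  have *: "basis_vec (u @ (a + b) # v) - basis_vec (u @ a # v) - basis_vec (u @ b # v) \<in> tensor_rel"
      "basis_vec (u @ scale c a # v) - fscale c (basis_vec (u @ a # v)) \<in> tensor_rel"
    if "length u + length v + 1 = 2" for u v a b c
    unfolding multilinear_rel_def using that by (intro free.span_base; blast)+
  show "linear_mod tensor_rel (\<lambda>a. basis_vec [a, b])"
    using *[of "[]" "[b]"] by (simp add: linear_mod_def)
  show "linear_mod tensor_rel (\<lambda>b. basis_vec [a, b])"
    using *[of "[a]" "[]"] by (simp add: linear_mod_def)
qed

text \<open>The generators lie in the subspace of combinations of words of length 2. Hence every
  representative of an element of the tensor square, also one picked by \<open>rep\<close>, is
  supported on such words.\<close>

lemma tensor_rel_length:
  assumes "x \<in> tensor_rel" "w \<in> Poly_Mapping.keys x"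
  shows "length w = 2"
proof -
  define P :: "('a list \<Rightarrow>\<^sub>0 'k) set" where "P = {p. \<forall>w\<in>Poly_Mapping.keys p. length w = 2}"
  have P: "free.subspace P" unfolding P_def by (rule subspace_supported)
  have "basis_vec w \<in> P" if "length w = 2" for w
    using that by (simp add: P_def)
  note intros = free.subspace_diff[OF P] free.subspace_scale[OF P] this
  have "basis_vec (u @ (a + b) # v) - basis_vec (u @ a # v) - basis_vec (u @ b # v) \<in> P"
    "basis_vec (u @ scale c a # v) - fscale c (basis_vec (u @ a # v)) \<in> P"
    if "length u + length v + 1 = 2" for u v a b c
    using that by (intro intros; simp)+
  then have "tensor_rel \<subseteq> P"
    unfolding multilinear_rel_def by (intro free.span_minimal P) blast
  then show ?thesis using assms by (auto simp: P_def)
qed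

lemma pure_tensor_eq: "pure_tensor scale [a, b] = basis_vec [a, b] +o tensor_rel"
  by (simp add: pure_tensor_def numeral_2_eq_2)

lemma pure_tensor_in_tensor_power: "pure_tensor scale [a, b] \<in> tensor_power scale 2"
  unfolding pure_tensor_eq tensor_power_def by force

lemma \<Phi>_pure_tensor: "\<Phi> (pure_tensor scale [a, b]) = \<phi> a b +o tensor_rel"
  and \<phi>_length: "w \<in> Poly_Mapping.keys (\<phi> a b) \<Longrightarrow> length w = 2"
proof -
  have "\<Phi> (pure_tensor scale [a, b]) \<in> tensor_power scale 2"
    using linear_\<Phi> pure_tensor_in_tensor_power unfolding linear_tensor_endo_def by blast
  then obtain x where x: "\<Phi> (pure_tensor scale [a, b]) = x +o tensor_rel"
      "\<forall>w\<in>Poly_Mapping.keys x. length w = 2"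
    unfolding tensor_power_def by blast
  then have *: "\<phi> a b - x \<in> tensor_rel"
    unfolding \<phi>_def by (simp add: rep_coset subspace_tensor_rel)
  then show "\<Phi> (pure_tensor scale [a, b]) = \<phi> a b +o tensor_rel"
    by (simp add: x(1) coset_eq_iff subspace_tensor_rel)
      (metis "*" free.subspace_neg minus_diff_eq subspace_tensor_rel)
  have "Poly_Mapping.keys (x + (\<phi> a b - x)) \<subseteq> Poly_Mapping.keys x \<union> Poly_Mapping.keys (\<phi> a b - x)"
    by (rule keys_add)
  then show "length w = 2" if "w \<in> Poly_Mapping.keys (\<phi> a b)"
    using that x(2) tensor_rel_length[OF *] by auto
qed

lemma in_\<Phi>_pure_tensor_iff: "y \<in> \<Phi> (pure_tensor scale [a, b]) \<longleftrightarrow> y - \<phi> a b \<in> tensor_rel"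
  by (simp add: \<Phi>_pure_tensor set_minus_plus)

lemma \<phi>_cong:
  assumes "\<Phi> (pure_tensor scale [a, b]) = x +o tensor_rel"
  shows "\<phi> a b - x \<in> tensor_rel"
  using assms by (simp add: \<Phi>_pure_tensor coset_eq_iff subspace_tensor_rel)

text \<open>Pure tensors are bilinear as cosets and \<Phi> is linear on cosets. Combining the two
  gives equations between cosets, which \<open>\<phi>_cong\<close> turns into memberships for
  representatives.\<close>

lemma \<phi>_linear_mod: "linear_mod tensor_rel (\<lambda>a. \<phi> a b)" "linear_mod tensor_rel (\<lambda>b. \<phi> a b)"
proof -
  note U = subspace_tensor_rel
  have \<Phi>_add: "\<Phi> (pure_tensor scale [a, b] + pure_tensor scale [c, d]) = (\<phi> a b + \<phi> c d) +o tensor_rel"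
    for a b c d
    using linear_\<Phi> pure_tensor_in_tensor_power unfolding linear_tensor_endo_def
    by (simp add: \<Phi>_pure_tensor coset_plus[OF U])
  have \<Phi>_scale: "\<Phi> (qscale tensor_rel c (pure_tensor scale [a, b])) = fscale c (\<phi> a b) +o tensor_rel"
    for a b c
    using linear_\<Phi> pure_tensor_in_tensor_power unfolding linear_tensor_endo_def
    by (simp add: \<Phi>_pure_tensor qscale_coset[OF U])
  have pure_add: "pure_tensor scale [a + c, b] = pure_tensor scale [a, b] + pure_tensor scale [c, b]"
      "pure_tensor scale [b, a + c] = pure_tensor scale [b, a] + pure_tensor scale [b, c]" for a b c
    using tensor_linear_mod
    by (simp_all add: pure_tensor_eq coset_plus[OF U] coset_eq_iff[OF U] linear_mod_def diff_diff_eq)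
  have pure_scale: "pure_tensor scale [scale c a, b] = qscale tensor_rel c (pure_tensor scale [a, b])"
      "pure_tensor scale [b, scale c a] = qscale tensor_rel c (pure_tensor scale [b, a])" for a b c
    using tensor_linear_mod
    by (simp_all add: pure_tensor_eq qscale_coset[OF U] coset_eq_iff[OF U] linear_mod_def)
  show "linear_mod tensor_rel (\<lambda>a. \<phi> a b)" "linear_mod tensor_rel (\<lambda>b. \<phi> a b)"
    unfolding linear_mod_def diff_diff_eq
    by (intro conjI allI \<phi>_cong; simp only: pure_add pure_scale \<Phi>_add \<Phi>_scale)+
qed

text \<open>Over a field, nonzero \<open>a\<close> and \<open>b\<close> admit linear forms
  \<open>f\<close> and \<open>g\<close> with value 1 at them. The form induced by \<open>f\<close>
  and \<open>g\<close> on words kills all relations but is 1 on the word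
  \<open>[a, b]\<close>.\<close>

lemma basis_vec_in_tensor_rel_iff: "basis_vec [a, b] \<in> tensor_rel \<longleftrightarrow> a = 0 \<or> b = 0"
proof
  show "a = 0 \<or> b = 0 \<Longrightarrow> basis_vec [a, b] \<in> tensor_rel"
    using tensor_linear_mod[THEN linear_mod_zero] by blast
  assume ab: "basis_vec [a, b] \<in> tensor_rel"
  interpret K: vector_space "(*) :: 'k \<Rightarrow> 'k \<Rightarrow> 'k"
    by unfold_locales (simp_all add: algebra_simps)
  interpret AK: vector_space_pair scale "(*) :: 'k \<Rightarrow> 'k \<Rightarrow> 'k"
    by unfold_locales
  have functional: "\<exists>f. module_hom scale (*) f \<and> f a = 1" if "a \<noteq> 0" for a
    using AK.linear_independent_extend[of "{a}" "\<lambda>_. 1"] that by (auto simp: module_hom_iff_linear)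
  show "a = 0 \<or> b = 0"
  proof (rule ccontr)
    assume "\<not> (a = 0 \<or> b = 0)"
    then obtain f g where f: "module_hom scale (*) f" "f a = 1" and g: "module_hom scale (*) g" "g b = 1"
      using functional by blast
    define h where "h = K.lincomb (\<lambda>w. f (w ! 0) * g (w ! 1))"
    have h: "module_hom fscale (*) h"
      unfolding h_def by (rule K.module_hom_lincomb)
    have h_basis [simp]: "h (basis_vec w) = f (w ! 0) * g (w ! 1)" for w
      by (simp add: h_def)
    have "tensor_rel \<subseteq> {p. h p = 0}"
      unfolding multilinear_rel_def
    proof (rule free.span_minimal, safe)
      show "free.subspace {p. h p = 0}"
        using h by (rule module_hom.subspace_kernel)
      fix u v :: "'a list" and a b c assume "length u + length v + 1 = 2"
      \<comment> \<open>The relation varies either the first or the second letter; linearity of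
        \<open>f\<close> or of \<open>g\<close> then applies.\<close>
      then consider d where "u = []" "v = [d]" | d where "u = [d]" "v = []"
        by (cases u; cases v) auto
      then have "h (basis_vec (u @ (a + b) # v) - basis_vec (u @ a # v) - basis_vec (u @ b # v)) = 0 \<and>
          h (basis_vec (u @ scale c a # v) - fscale c (basis_vec (u @ a # v))) = 0"
        by cases (simp_all add: module_hom.diff[OF h] module_hom.scale[OF h] module_hom.add[OF f(1)]
            module_hom.add[OF g(1)] module_hom.scale[OF f(1)] module_hom.scale[OF g(1)] distrib_left
            distrib_right)
      then show "h (basis_vec (u @ (a + b) # v) - basis_vec (u @ a # v) - basis_vec (u @ b # v)) = 0"
        "h (basis_vec (u @ scale c a # v) - fscale c (basis_vec (u @ a # v))) = 0" by blast+
    qed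
    then show False using ab f(2) g(2) by auto
  qed
qed

text \<open>
  In arity 3 the rewriting \<open>a \<circ>\<^sub>2 b \<mapsto> \<Phi>(a \<otimes> b)\<close> identifies the operad with \<open>A \<otimes> A\<close>.
\<close>

fun straighten :: "'a ptree \<Rightarrow> ('a list \<Rightarrow>\<^sub>0 'k)" where
  "straighten (Node a (Node b Leaf Leaf) Leaf) = basis_vec [a, b]"
| "straighten (Node a Leaf (Node b Leaf Leaf)) = \<phi> a b"
| "straighten _ = 0"

text \<open>
  Contains the ideal. Since compositions with arities at least 2 raise the arity and the ideal is
  zero below arity 2, nothing needs to be recorded above arity 3.
\<close>

definition vanishing :: "nat \<Rightarrow> ('a ptree \<Rightarrow>\<^sub>0 'k) \<Rightarrow> bool" where
  "vanishing n x \<longleftrightarrow> x \<in> free_op n \<and> (n < 2 \<longrightarrow> x = 0) \<and> (n = 2 \<longrightarrow> lincomb label x = 0)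
     \<and> (n = 3 \<longrightarrow> lin_ext straighten x \<in> tensor_rel)"

lemma vanishing_zero: "vanishing n 0"
  by (simp add: vanishing_def free.subspace_0 subspace_free_op subspace_tensor_rel)

lemma vanishing_scale: "vanishing n x \<Longrightarrow> vanishing n (fscale c x)"
  by (simp add: vanishing_def free.subspace_scale subspace_free_op subspace_tensor_rel
      lin_ext_scale lincomb_scale)

text \<open>With the other corolla fixed, straightening the composition is a function of the label
  alone, linear modulo \<open>tensor_rel\<close>: a pure tensor or a value of \<open>\<phi>\<close>.
  On a combination with label sum 0 it therefore vanishes.\<close>

lemma straighten_comp_in_tensor_rel:
  assumes "x \<in> free_op 2" "lincomb label x = 0" "y \<in> free_op 2"
  shows "lin_ext straighten (free_comp i x y) \<in> tensor_rel"
    and "lin_ext straighten (free_comp i y x) \<in> tensor_rel"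
proof -
  note U = subspace_tensor_rel
  have null: "lin_ext (\<lambda>t. g (label t)) x \<in> tensor_rel" if "linear_mod tensor_rel g" for g
    using free.subspace_add[OF U linear_mod_lincomb[OF U that] linear_mod_zero[OF that], of label x] assms(2)
    by simp
  have tree: "t \<in> Poly_Mapping.keys x \<Longrightarrow> t = Node (label t) Leaf Leaf"
    "t \<in> Poly_Mapping.keys y \<Longrightarrow> t = Node (label t) Leaf Leaf" for t
    using assms(1,3) leaves_eq_2[of t] by (auto simp: free_op_def)
  have "lin_ext straighten (free_comp i x y) =
      lin_ext (\<lambda>s. lin_ext (\<lambda>t. straighten (graft i t s)) x) y"
    by (simp add: free_comp_swap lin_ext_lin_ext)
  also have "\<dots> \<in> tensor_rel"
  proof (rule lin_ext_in_subspace[OF U])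
    fix s assume "s \<in> Poly_Mapping.keys y"
    then obtain b where b: "s = Node b Leaf Leaf" using tree by blast
    \<comment> \<open>The test \<open>i \<le> 1\<close> follows \<open>graft\<close>, which uses the
      first leaf also for index 0.\<close>
    have "lin_ext (\<lambda>t. straighten (graft i t s)) x =
        lin_ext (\<lambda>t. (if i \<le> 1 then basis_vec [label t, b] else \<phi> (label t) b)) x"
    proof (rule lin_ext_cong)
      fix t assume "t \<in> Poly_Mapping.keys x"
      then obtain a where "t = Node a Leaf Leaf" using tree by blast
      then show "straighten (graft i t s) = (if i \<le> 1 then basis_vec [label t, b] else \<phi> (label t) b)"
        by (simp add: b)
    qed
    also have "\<dots> \<in> tensor_rel"
      using null[OF tensor_linear_mod(1)] null[OF \<phi>_linear_mod(1)] by (cases "i \<le> 1") simp_all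
    finally show "lin_ext (\<lambda>t. straighten (graft i t s)) x \<in> tensor_rel" .
  qed
  finally show "lin_ext straighten (free_comp i x y) \<in> tensor_rel" .
  have "lin_ext straighten (free_comp i y x) =
      lin_ext (\<lambda>s. lin_ext (\<lambda>t. straighten (graft i s t)) x) y"
    by (simp add: free_comp_def lin_ext_lin_ext)
  also have "\<dots> \<in> tensor_rel"
  proof (rule lin_ext_in_subspace[OF U])
    fix s assume "s \<in> Poly_Mapping.keys y"
    then obtain b where b: "s = Node b Leaf Leaf" using tree by blast
    have "lin_ext (\<lambda>t. straighten (graft i s t)) x =
        lin_ext (\<lambda>t. (if i \<le> 1 then basis_vec [b, label t] else \<phi> b (label t))) x"
    proof (rule lin_ext_cong)
      fix t assume "t \<in> Poly_Mapping.keys x"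
      then obtain a where "t = Node a Leaf Leaf" using tree by blast
      then show "straighten (graft i s t) = (if i \<le> 1 then basis_vec [b, label t] else \<phi> b (label t))"
        by (simp add: b)
    qed
    also have "\<dots> \<in> tensor_rel"
      using null[OF tensor_linear_mod(2)] null[OF \<phi>_linear_mod(2)] by (cases "i \<le> 1") simp_all
    finally show "lin_ext (\<lambda>t. straighten (graft i s t)) x \<in> tensor_rel" .
  qed
  finally show "lin_ext straighten (free_comp i y x) \<in> tensor_rel" .
qed

lemma vanishing_as_rel:
  assumes "x \<in> as_rel scale \<Phi> n"
  shows "vanishing n x"
proof -
  note op2 = free.subspace_diff[OF subspace_free_op] free.subspace_scale[OF subspace_free_op] corolla_in_free_op
  have label: "lincomb label (corolla a) = a" for a
    by (simp add: corolla_def)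
  consider a b where "n = 2" "x = corolla (a + b) - corolla a - corolla b"
    | c a where "n = 2" "x = corolla (scale c a) - fscale c (corolla a)"
    | a b y where "n = 3" "y \<in> \<Phi> (pure_tensor scale [a, b])"
      "x = free_comp 2 (corolla a) (corolla b) -
         lin_ext (\<lambda>w. free_comp 1 (corolla (w ! 0)) (corolla (w ! 1))) y"
    using assms by (auto simp: as_rel_def split: if_splits)
  then show ?thesis
  proof cases
    case 1
    then show ?thesis by (simp add: vanishing_def op2 lincomb_diff label)
  next
    case 2
    then show ?thesis by (simp add: vanishing_def op2 lincomb_diff lincomb_scale label)
  next
    case 3
    have y: "y - \<phi> a b \<in> tensor_rel"
      using 3(2) by (simp add: in_\<Phi>_pure_tensor_iff)
    have len: "length w = 2" if "w \<in> Poly_Mapping.keys y" for w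
    proof -
      have "w \<in> Poly_Mapping.keys (\<phi> a b) \<union> Poly_Mapping.keys (y - \<phi> a b)"
        using that keys_add[of "\<phi> a b" "y - \<phi> a b"] by auto
      then show ?thesis using \<phi>_length tensor_rel_length[OF y] by blast
    qed
    \<comment> \<open>Straightening the left combs of the relation rebuilds each word from its first
      two letters. Since all words in \<open>y\<close> have length 2, this returns \<open>y\<close>
      itself, to be compared with \<open>\<phi> a b\<close>.\<close>
    have "basis_vec [w ! 0, w ! 1] = basis_vec w" if "w \<in> Poly_Mapping.keys y" for w
      using len[OF that] by (cases w rule: remdups_adj.cases) auto
    then have "lin_ext (\<lambda>w. basis_vec [w ! 0, w ! 1]) y = lin_ext basis_vec y"
      by (rule lin_ext_cong)
    then have "lin_ext straighten x = \<phi> a b - y"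
      by (simp add: 3 free_comp_corolla lin_ext_diff lin_ext_lin_ext del: One_nat_def)
    moreover have "x \<in> free_op 3"
      unfolding 3 by (intro free.subspace_diff lin_ext_in_subspace subspace_free_op)
        (simp_all add: free_comp_corolla free_op_def del: One_nat_def)
    ultimately show ?thesis
      using free.subspace_neg[OF subspace_tensor_rel y] 3(1) by (simp add: vanishing_def)
  qed
qed

text \<open>If both factors are nonzero, then \<open>x\<close> has arity at least 2 and
  \<open>y\<close> at least 1. Either \<open>y\<close> is a multiple of the unit, or both have arity
  2, or the result has arity above 3, where only the arity is recorded.\<close>

lemma vanishing_comp:
  assumes "vanishing n x" "y \<in> free_op m"
  shows "1 \<le> m \<Longrightarrow> vanishing (m + n - 1) (free_comp i y x)"
    and "1 \<le> n \<Longrightarrow> vanishing (n + m - 1) (free_comp i x y)"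
proof -
  have "vanishing (m + n - 1) (free_comp i y x) \<and> vanishing (n + m - 1) (free_comp i x y)"
    if "x \<noteq> 0" "y \<noteq> 0"
  proof -
    have n: "2 \<le> n" using assms(1) that by (auto simp: vanishing_def not_le)
    have "m \<noteq> 0" using assms(2) that(2) free_op_0[of y] by (cases m) auto
    then consider "m = 1" | "m = 2" "n = 2" | "m + n - 1 > 3"
      using n by linarith
    then show ?thesis
    proof cases
      case 1
      then obtain c where "y = fscale c (basis_vec Leaf)"
        using assms(2) free_op_1_scalar by blast
      then show ?thesis
        using 1 assms(1) by (simp add: free_comp_scalar_left free_comp_scalar_right vanishing_scale)
    next
      case 2
      then show ?thesis
        using assms straighten_comp_in_tensor_rel[of x y i]
          free_comp_in_free_op[of x 2 y 2 i] free_comp_in_free_op[of y 2 x 2 i]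
        by (simp add: vanishing_def)
    next
      case 3
      then show ?thesis
        using assms free_comp_in_free_op[of x n y m i] free_comp_in_free_op[of y m x n i]
        by (simp add: vanishing_def add.commute)
    qed
  qed
  then show "vanishing (m + n - 1) (free_comp i y x)" "vanishing (n + m - 1) (free_comp i x y)"
    by (cases "x = 0"; cases "y = 0"; simp add: vanishing_zero)+
qed

text \<open>Induction on the generation of the ideal. The later proofs that an element is not in the
  ideal rest on this invariant.\<close>

lemma vanishing_ideal: "x \<in> ideal n \<Longrightarrow> vanishing n x"
  unfolding as_ideal_def mem_Collect_eq
proof (induction rule: operad_ideal.induct)
  case (gen x n)
  then show ?case by (rule vanishing_as_rel)
next
  case (zero n)
  then show ?case by (rule vanishing_zero)
next
  case (add n x y)
  then show ?case
    by (simp add: vanishing_def free.subspace_add subspace_free_op subspace_tensor_rel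
        lin_ext_add lincomb_add)
next
  case (scale n x c)
  from scale.IH show ?case by (rule vanishing_scale)
next
  case (comp_left n x y m i)
  then show ?case by (intro vanishing_comp) auto
next
  case (comp_right n x y m i)
  then show ?case by (intro vanishing_comp) auto
qed

section \<open>Compositions of cosets and the arity 2 component\<close>

lemma subspace_ideal: "free.subspace (ideal n)"
  by (rule free.subspaceI) (auto simp: as_ideal_def intro: operad_ideal.intros(2-4))

lemma as_rel_in_ideal: "x \<in> as_rel scale \<Phi> n \<Longrightarrow> x \<in> ideal n"
  by (simp add: as_ideal_def operad_ideal.gen)

lemma ideal_comp:
  assumes "x \<in> ideal n" "y \<in> free_op m" "1 \<le> i"
  shows "i \<le> m \<Longrightarrow> free_comp i y x \<in> ideal (m + n - 1)"
    and "i \<le> n \<Longrightarrow> free_comp i x y \<in> ideal (n + m - 1)"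
  using assms operad_ideal.comp_left[of _ n x y m i] operad_ideal.comp_right[of _ n x y m i]
  by (simp_all add: as_ideal_def)

text \<open>The error made by the chosen representatives is split by bilinearity into two
  compositions, each with one factor in the ideal.\<close>

lemma As_comp_coset:
  assumes x: "x \<in> free_op m" and y: "y \<in> free_op n" and i: "1 \<le> i" "i \<le> m"
  shows "As_comp scale \<Phi> m n i (x +o ideal m) (y +o ideal n) = free_comp i x y +o ideal (m + n - 1)"
proof -
  let ?x = "rep (x +o ideal m)" and ?y = "rep (y +o ideal n)"
  have dx: "?x - x \<in> ideal m" and dy: "?y - y \<in> ideal n"
    by (simp_all add: rep_coset subspace_ideal)
  \<comment> \<open>Closure of the ideal under composition asks the other factor to be homogeneous.
    The chosen \<open>?y\<close> is, since it differs from \<open>y\<close> by an ideal element,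
    supported on trees with \<open>n\<close> leaves.\<close>
  then have "?y - y \<in> free_op n"
    using vanishing_ideal by (simp add: vanishing_def)
  from free.subspace_add[OF subspace_free_op y this] have "?y \<in> free_op n"
    by simp
  then have "free_comp i (?x - x) ?y + free_comp i x (?y - y) \<in> ideal (m + n - 1)"
    using dx dy x i by (intro free.subspace_add[OF subspace_ideal] ideal_comp)
  then have "free_comp i ?x ?y - free_comp i x y \<in> ideal (m + n - 1)"
    by (simp add: free_comp_diff_left free_comp_diff_right)
  then show ?thesis
    by (simp add: As_comp_def coset_eq_iff[OF subspace_ideal])
qed

lemma corolla_linear_mod: "linear_mod (ideal 2) corolla"
  unfolding linear_mod_def
  by (intro conjI allI as_rel_in_ideal; simp add: as_rel_def; blast)

lemma corolla_in_ideal_iff: "corolla a \<in> ideal 2 \<longleftrightarrow> a = 0"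
  using linear_mod_zero[OF corolla_linear_mod] vanishing_ideal[of "corolla a" 2]
  by (auto simp: vanishing_def corolla_def)

text \<open>All trees of arity 2 are corollas, and the linearity relations merge a combination of
  corollas into one.\<close>

lemma As_2_eq: "As scale \<Phi> 2 = range (\<lambda>a. corolla a +o ideal 2)"
proof (intro equalityI subsetI)
  fix X assume "X \<in> As scale \<Phi> 2"
  then obtain x where x: "X = x +o ideal 2" "x \<in> free_op 2"
    unfolding As_def by blast
  have "corolla (label t) = basis_vec t" if "t \<in> Poly_Mapping.keys x" for t
    using that x(2) leaves_eq_2[of t] by (auto simp: free_op_def corolla_def)
  then have "lin_ext (\<lambda>t. corolla (label t)) x = lin_ext basis_vec x"
    by (rule lin_ext_cong)
  then have "x - corolla (lincomb label x) \<in> ideal 2"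
    using linear_mod_lincomb[OF subspace_ideal corolla_linear_mod, of label x] by simp
  then show "X \<in> range (\<lambda>a. corolla a +o ideal 2)"
    using x(1) by (auto simp: coset_eq_iff[OF subspace_ideal])
qed (auto simp: As_def corolla_in_free_op)

section \<open>The two combs in arity 3\<close>

definition left_comb :: "'a \<Rightarrow> 'a \<Rightarrow> ('a ptree \<Rightarrow>\<^sub>0 'k)" where
  "left_comb a b = free_comp 1 (corolla a) (corolla b)"

definition right_comb :: "'a \<Rightarrow> 'a \<Rightarrow> ('a ptree \<Rightarrow>\<^sub>0 'k)" where
  "right_comb a b = free_comp 2 (corolla a) (corolla b)"

lemma lin_ext_straighten_comb [simp]:
  "lin_ext straighten (left_comb a b) = basis_vec [a, b]"
  "lin_ext straighten (right_comb a b) = \<phi> a b"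
  by (simp_all only: left_comb_def right_comb_def free_comp_corolla lin_ext_basis_vec straighten.simps)

lemma ideal_3_straighten: "x \<in> ideal 3 \<Longrightarrow> lin_ext straighten x \<in> tensor_rel"
  using vanishing_ideal[of x 3] by (simp add: vanishing_def)

lemma comb_in_ideal:
  assumes "a = 0 \<or> b = 0"
  shows "left_comb a b \<in> ideal 3" "right_comb a b \<in> ideal 3"
proof -
  have "free_comp i (corolla a) (corolla b) \<in> ideal 3" if "1 \<le> i" "i \<le> 2" for i
    using assms that ideal_comp[of "corolla a" 2 "corolla b" 2 i] ideal_comp[of "corolla b" 2 "corolla a" 2 i]
    by (auto simp: corolla_in_free_op corolla_in_ideal_iff)
  then show "left_comb a b \<in> ideal 3" "right_comb a b \<in> ideal 3"
    by (simp_all add: left_comb_def right_comb_def)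
qed

lemma left_comb_in_ideal_iff: "left_comb a b \<in> ideal 3 \<longleftrightarrow> a = 0 \<or> b = 0"
  using ideal_3_straighten[of "left_comb a b"] comb_in_ideal basis_vec_in_tensor_rel_iff by auto

lemma right_comb_relation:
  assumes "y \<in> \<Phi> (pure_tensor scale [a, b])"
  shows "right_comb a b - lin_ext (\<lambda>w. left_comb (w ! 0) (w ! 1)) y \<in> ideal 3"
  unfolding left_comb_def right_comb_def
  by (rule as_rel_in_ideal) (use assms in \<open>auto simp: as_rel_def\<close>)

lemma right_comb_in_ideal_iff:
  "right_comb a b \<in> ideal 3 \<longleftrightarrow> \<Phi> (pure_tensor scale [a, b]) = tensor_rel"
proof
  assume "right_comb a b \<in> ideal 3"
  then have "\<phi> a b \<in> tensor_rel" using ideal_3_straighten by fastforce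
  then show "\<Phi> (pure_tensor scale [a, b]) = tensor_rel"
    by (simp add: \<Phi>_pure_tensor coset_eq_subspace_iff subspace_tensor_rel)
next
  assume "\<Phi> (pure_tensor scale [a, b]) = tensor_rel"
  \<comment> \<open>The relation holds for every representative; the representative 0 leaves the
    right comb alone.\<close>
  then have "0 \<in> \<Phi> (pure_tensor scale [a, b])"
    by (simp add: free.subspace_0 subspace_tensor_rel)
  from right_comb_relation[OF this] show "right_comb a b \<in> ideal 3" by simp
qed

lemma left_comb_minus_right_comb_in_ideal_iff:
  "left_comb a b - right_comb a b \<in> ideal 3 \<longleftrightarrow>
     \<Phi> (pure_tensor scale [a, b]) = pure_tensor scale [a, b]"
proof
  assume "left_comb a b - right_comb a b \<in> ideal 3"
  then have "basis_vec [a, b] - \<phi> a b \<in> tensor_rel"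
    using ideal_3_straighten by (fastforce simp: lin_ext_diff)
  then have "pure_tensor scale [a, b] = \<Phi> (pure_tensor scale [a, b])"
    unfolding \<Phi>_pure_tensor unfolding pure_tensor_eq coset_eq_iff[OF subspace_tensor_rel] .
  then show "\<Phi> (pure_tensor scale [a, b]) = pure_tensor scale [a, b]" by simp
next
  assume "\<Phi> (pure_tensor scale [a, b]) = pure_tensor scale [a, b]"
  \<comment> \<open>With this representative the relation compares the right comb with the single
    left comb on the same labels.\<close>
  then have "basis_vec [a, b] \<in> \<Phi> (pure_tensor scale [a, b])"
    using set_plus_intro2[OF free.subspace_0[OF subspace_tensor_rel], of "basis_vec [a, b]"]
    by (simp add: pure_tensor_eq)
  from free.subspace_neg[OF subspace_ideal right_comb_relation[OF this]]
  show "left_comb a b - right_comb a b \<in> ideal 3" by simp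
qed

end

section \<open>Binary operations of the symmetrisation\<close>

declare One_nat_def [simp del]

lemma Sym_2: "Sym 2 = {[1, 2], [2, 1]}"
proof -
  have "{1..2} = {1, 2 :: nat}" by auto
  then show ?thesis by (simp add: permutations_of_set_doubleton)
qed

lemma Sym_3: "Sym 3 = {[1, 2, 3], [1, 3, 2], [2, 1, 3], [2, 3, 1], [3, 1, 2], [3, 2, 1]}"
proof -
  have *: "{1..3} = {1, 2, 3 :: nat}" "{1, 2, 3} - {1} = {2, 3 :: nat}"
    "{1, 2, 3} - {2} = {1, 3 :: nat}" "{1, 2, 3} - {3} = {1, 2 :: nat}" by auto
  show ?thesis
    unfolding * by (subst permutations_of_set_nonempty) (auto simp: * permutations_of_set_doubleton)
qed

lemma word_pos_2:
  "word_pos 1 [1, 2] = 1" "word_pos 2 [1, 2] = 2" "word_pos 1 [2, 1] = 2" "word_pos 2 [2, 1] = 1"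
  unfolding word_pos_def by (rule the_equality; auto simp: nth_Cons' split: if_splits)+

text \<open>\<open>P\<close> stands for the condition that a pair of words composes to a given word,
  so that one expansion serves both inputs and all six words.\<close>

lemma sum_Sym_2:
  fixes F :: "nat list \<Rightarrow> nat list \<Rightarrow> 'b::comm_monoid_add"
  shows "(\<Sum>(w, v)\<in>{(w, v). w \<in> Sym 2 \<and> v \<in> Sym 2 \<and> P w v}. F w v) =
    (if P [1, 2] [1, 2] then F [1, 2] [1, 2] else 0) + (if P [1, 2] [2, 1] then F [1, 2] [2, 1] else 0) +
    (if P [2, 1] [1, 2] then F [2, 1] [1, 2] else 0) + (if P [2, 1] [2, 1] then F [2, 1] [2, 1] else 0)"
proof -
  have "{(w, v). w \<in> Sym 2 \<and> v \<in> Sym 2 \<and> P w v} =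
      {x \<in> Sym 2 \<times> Sym 2. case x of (w, v) \<Rightarrow> P w v}"
    by auto
  then have "(\<Sum>(w, v)\<in>{(w, v). w \<in> Sym 2 \<and> v \<in> Sym 2 \<and> P w v}. F w v) =
      (\<Sum>w\<in>Sym 2. \<Sum>v\<in>Sym 2. if P w v then F w v else 0)"
    by (simp add: sum.inter_filter sum.cartesian_product split_def)
  then show ?thesis by (simp add: Sym_2 add.assoc)
qed

text \<open>For each input the four pairs give four distinct words. The two inputs share only
  \<open>[1, 2, 3]\<close> and \<open>[3, 2, 1]\<close>; each of the other four words arises for
  just one input.\<close>

lemma word_comp_2:
  "word_comp 1 [1, 2] [1, 2] = [1, 2, 3]" "word_comp 1 [1, 2] [2, 1] = [2, 1, 3]"
  "word_comp 1 [2, 1] [1, 2] = [3, 1, 2]" "word_comp 1 [2, 1] [2, 1] = [3, 2, 1]"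
  "word_comp 2 [1, 2] [1, 2] = [1, 2, 3]" "word_comp 2 [1, 2] [2, 1] = [1, 3, 2]"
  "word_comp 2 [2, 1] [1, 2] = [2, 3, 1]" "word_comp 2 [2, 1] [2, 1] = [3, 2, 1]"
  by (simp_all add: word_comp_def)

context tensor_square
begin

text \<open>This is \<open>*\<^sub>a + *\<^sub>b\<^sup>o\<^sup>p\<close>, written as its family of
  components.\<close>

definition binary :: "'a \<Rightarrow> 'a \<Rightarrow> (nat list \<Rightarrow> ('a ptree \<Rightarrow>\<^sub>0 'k) set)" where
  "binary a b = (\<lambda>w\<in>Sym 2. corolla (if w = [1, 2] then a else b) +o ideal 2)"

lemma SymAs_2_eq: "SymAs scale \<Phi> 2 = {binary a b | a b. True}"
proof (intro equalityI subsetI)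
  fix m assume "m \<in> SymAs scale \<Phi> 2"
  then have m: "m \<in> Sym 2 \<rightarrow>\<^sub>E As scale \<Phi> 2" by (simp add: SymAs_def)
  then have "m [1, 2] \<in> As scale \<Phi> 2" "m [2, 1] \<in> As scale \<Phi> 2"
    by (auto simp: Sym_2)
  then obtain a b where "m [1, 2] = corolla a +o ideal 2" "m [2, 1] = corolla b +o ideal 2"
    unfolding As_2_eq by blast
  then have "m = binary a b"
    using m by (intro PiE_ext[of m "Sym 2" "\<lambda>_. As scale \<Phi> 2" "binary a b"])
      (auto simp: binary_def Sym_2 As_2_eq)
  then show "m \<in> {binary a b | a b. True}" by blast
qed (auto simp: SymAs_def binary_def As_2_eq)

lemma star_eq_binary: "star scale \<Phi> a = binary a 0"
  and star_op_eq_binary: "star_op scale \<Phi> b = binary 0 b"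
proof -
  have "corolla 0 +o ideal 2 = ideal 2"
    by (simp add: coset_eq_subspace_iff[OF subspace_ideal] corolla_in_ideal_iff)
  then show "star scale \<Phi> a = binary a 0" "star_op scale \<Phi> b = binary 0 b"
    unfolding star_def star_op_def SymAs_elem_def binary_def Sym_2
    by (intro restrict_ext; force)+
qed

lemma SymAs_comp_binary:
  assumes "i \<in> {1, 2}"
  shows "SymAs_comp scale \<Phi> 2 2 i (binary a b) (binary a b) = (\<lambda>u\<in>Sym 3.
     (\<Sum>(w, v)\<in>{(w, v). w \<in> Sym 2 \<and> v \<in> Sym 2 \<and> word_comp i w v = u}.
        free_comp (word_pos i w) (corolla (if w = [1, 2] then a else b))
          (corolla (if v = [1, 2] then a else b))) +o ideal 3)"
proof -
  define g :: "nat list \<times> nat list \<Rightarrow> ('a ptree \<Rightarrow>\<^sub>0 'k)"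
    where "g = (\<lambda>(w, v). free_comp (word_pos i w) (corolla (if w = [1, 2] then a else b))
        (corolla (if v = [1, 2] then a else b)))"
  \<comment> \<open>The added \<open>ideal 3\<close> turns the empty sum into the zero coset, as
    needed for the words that no pair produces; in other sums it is absorbed.\<close>
  have coset_sum: "(\<Sum>x\<in>S. g x +o ideal 3) + ideal 3 = (\<Sum>x\<in>S. g x) +o ideal 3"
    if "finite S" for S
    using that
  proof induction
    case (insert x S)
    then show ?case by (simp add: add.assoc coset_plus[OF subspace_ideal])
  qed simp
  have arity: "2 + 2 - 1 = (3 :: nat)" by simp
  have comp: "As_comp scale \<Phi> 2 2 (word_pos i w) (binary a b w) (binary a b v) = g (w, v) +o ideal 3"
    if "w \<in> Sym 2" "v \<in> Sym 2" for w v
  proof -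
    have "word_pos i w \<in> {1, 2}"
      using that assms word_pos_2 by (auto simp: Sym_2)
    then have "1 \<le> word_pos i w" "word_pos i w \<le> 2" by auto
    from As_comp_coset[OF corolla_in_free_op corolla_in_free_op this] show ?thesis
      using that unfolding g_def binary_def arity by simp
  qed
  have sum_comp: "(\<Sum>(w, v)\<in>S. As_comp scale \<Phi> 2 2 (word_pos i w) (binary a b w) (binary a b v)) + ideal 3
      = (\<Sum>x\<in>S. g x) +o ideal 3" if "S \<subseteq> Sym 2 \<times> Sym 2" for S
  proof -
    have "(\<Sum>(w, v)\<in>S. As_comp scale \<Phi> 2 2 (word_pos i w) (binary a b w) (binary a b v))
        = (\<Sum>x\<in>S. g x +o ideal 3)"
      using that comp by (intro sum.cong) auto
    moreover have "finite S"
      using that by (rule finite_subset) simp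
    ultimately show ?thesis using coset_sum by simp
  qed
  show ?thesis
    unfolding SymAs_comp_def arity g_def[symmetric] by (rule restrict_ext, rule sum_comp) auto
qed

text \<open>In the opposite product the first input sits at leaf 2, so an outer \<open>b\<close>
  yields right combs.\<close>

lemma binary_comp_1: "SymAs_comp scale \<Phi> 2 2 1 (binary a b) (binary a b) = (\<lambda>u\<in>Sym 3.
    (if u = [1, 2, 3] then left_comb a a else if u = [2, 1, 3] then left_comb a b
     else if u = [3, 1, 2] then right_comb b a else if u = [3, 2, 1] then right_comb b b else 0)
    +o ideal 3)"
  unfolding SymAs_comp_binary[of 1, simplified] sum_Sym_2 word_comp_2 word_pos_2
  by (rule restrict_ext, rule arg_cong2[where f = "(+o)"])
    (auto simp: Sym_3 left_comb_def right_comb_def)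

text \<open>Mirror image: the second input of the opposite product sits at leaf 1, so an outer
  \<open>b\<close> yields left combs.\<close>

lemma binary_comp_2: "SymAs_comp scale \<Phi> 2 2 2 (binary a b) (binary a b) = (\<lambda>u\<in>Sym 3.
    (if u = [1, 2, 3] then right_comb a a else if u = [1, 3, 2] then right_comb a b
     else if u = [2, 3, 1] then left_comb b a else if u = [3, 2, 1] then left_comb b b else 0)
    +o ideal 3)"
  unfolding SymAs_comp_binary[of 2, simplified] sum_Sym_2 word_comp_2 word_pos_2
  by (rule restrict_ext, rule arg_cong2[where f = "(+o)"])
    (auto simp: Sym_3 left_comb_def right_comb_def)

section \<open>Comparison of the compositions word by word\<close>

lemma restrict_coset_eq_iff:
  "(\<lambda>u\<in>S. f u +o ideal n) = (\<lambda>u\<in>S. g u +o ideal n) \<longleftrightarrow> (\<forall>u\<in>S. f u - g u \<in> ideal n)"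
  unfolding fun_eq_iff restrict_def by (auto simp: coset_eq_iff[OF subspace_ideal])

lemma zero_in_ideal: "0 \<in> ideal n"
  by (rule free.subspace_0[OF subspace_ideal])

lemma neg_in_ideal_iff: "- x \<in> ideal n \<longleftrightarrow> x \<in> ideal n"
  using free.subspace_neg[OF subspace_ideal, of x n] free.subspace_neg[OF subspace_ideal, of "- x" n]
  by auto

lemma right_minus_left_in_ideal_iff:
  "right_comb a b - left_comb a b \<in> ideal 3 \<longleftrightarrow>
     \<Phi> (pure_tensor scale [a, b]) = pure_tensor scale [a, b]"
  using neg_in_ideal_iff[of "left_comb a b - right_comb a b" 3]
  by (simp add: left_comb_minus_right_comb_in_ideal_iff)

lemma binary_associative_iff:
  "SymAs_comp scale \<Phi> 2 2 1 (binary a b) (binary a b) =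
     SymAs_comp scale \<Phi> 2 2 2 (binary a b) (binary a b) \<longleftrightarrow>
   (a = 0 \<or> b = 0) \<and> \<Phi> (pure_tensor scale [a, a]) = pure_tensor scale [a, a] \<and>
     \<Phi> (pure_tensor scale [b, b]) = pure_tensor scale [b, b]"
  unfolding binary_comp_1 binary_comp_2 restrict_coset_eq_iff Sym_3
  \<comment> \<open>Once \<open>a\<close> or \<open>b\<close> is 0, all combs mixing
    \<open>a\<close> and \<open>b\<close> lie in the ideal, which settles the four words with only
    one contribution. At \<open>[3, 2, 1]\<close> the combs are subtracted in the order opposite to
    \<open>[1, 2, 3]\<close>.\<close>
  using comb_in_ideal[of a b] comb_in_ideal[of b a]
  by (auto simp: left_comb_in_ideal_iff left_comb_minus_right_comb_in_ideal_iff
      right_minus_left_in_ideal_iff neg_in_ideal_iff)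

lemma binary_comp_2_zero_iff:
  "SymAs_comp scale \<Phi> 2 2 2 (binary a b) (binary a b) = SymAs_zero scale \<Phi> 3 \<longleftrightarrow>
     b = 0 \<and> \<Phi> (pure_tensor scale [a, a]) = tensor_rel"
proof -
  have zero: "SymAs_zero scale \<Phi> 3 = (\<lambda>u\<in>Sym 3. 0 +o ideal 3)"
    by (simp add: SymAs_zero_def)
  show ?thesis
    unfolding zero binary_comp_2 restrict_coset_eq_iff Sym_3
    using comb_in_ideal[of a b] comb_in_ideal[of b a]
    by (auto simp: left_comb_in_ideal_iff right_comb_in_ideal_iff zero_in_ideal)
qed

text \<open>For the converse inclusion: \<open>*\<^sub>a\<close> is \<open>binary a 0\<close>, so
  the condition on the second component has to hold at 0, and symmetrically for the opposite
  products.\<close>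

lemma \<Phi>_pure_tensor_zero: "\<Phi> (pure_tensor scale [0, 0]) = pure_tensor scale [0, 0]"
  using left_comb_minus_right_comb_in_ideal_iff[of 0 0] comb_in_ideal[of 0 0]
    free.subspace_diff[OF subspace_ideal] by blast

end

theorem proposition3p12:
  fixes scale :: "'k::field \<Rightarrow> 'a::ab_group_add \<Rightarrow> 'a"
    and \<Phi> :: "('a list \<Rightarrow>\<^sub>0 'k) set \<Rightarrow> ('a list \<Rightarrow>\<^sub>0 'k) set"
  assumes "lEAS scale \<Phi>"
  shows "{m \<in> SymAs scale \<Phi> 2. SymAs_comp scale \<Phi> 2 2 1 m m = SymAs_comp scale \<Phi> 2 2 2 m m} =
           {star scale \<Phi> a | a. \<Phi> (pure_tensor scale [a, a]) = pure_tensor scale [a, a]} \<union>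
           {star_op scale \<Phi> a | a. \<Phi> (pure_tensor scale [a, a]) = pure_tensor scale [a, a]}
       \<and> {m \<in> SymAs scale \<Phi> 2. SymAs_comp scale \<Phi> 2 2 2 m m = SymAs_zero scale \<Phi> 3} =
           {star scale \<Phi> a | a. \<Phi> (pure_tensor scale [a, a]) = multilinear_rel scale 2}"
proof -
  interpret vector_space scale
    using assms by (simp add: lEAS_def)
  interpret tensor_square scale \<Phi>
    by unfold_locales (use assms in \<open>simp add: lEAS_def\<close>)
  show ?thesis
  proof (intro conjI)
    show "{m \<in> SymAs scale \<Phi> 2. SymAs_comp scale \<Phi> 2 2 1 m m = SymAs_comp scale \<Phi> 2 2 2 m m} =
        {star scale \<Phi> a | a. \<Phi> (pure_tensor scale [a, a]) = pure_tensor scale [a, a]} \<union>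
        {star_op scale \<Phi> a | a. \<Phi> (pure_tensor scale [a, a]) = pure_tensor scale [a, a]}"
      using \<Phi>_pure_tensor_zero unfolding SymAs_2_eq star_eq_binary star_op_eq_binary
      by (auto simp: binary_associative_iff)
    show "{m \<in> SymAs scale \<Phi> 2. SymAs_comp scale \<Phi> 2 2 2 m m = SymAs_zero scale \<Phi> 3} =
        {star scale \<Phi> a | a. \<Phi> (pure_tensor scale [a, a]) = multilinear_rel scale 2}"
      unfolding SymAs_2_eq star_eq_binary by (auto simp: binary_comp_2_zero_iff)
  qed
qed

end
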